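(* Let $\mathcal{C}$ be a finitely complete pointed category with binary sums (coproducts), in which any morphism $f:X\to Y$ can be decomposed as $f=me$ where $m$ is a monomorphism and $e$ is an epimorphism. Then $\mathcal{C}$ is an additive category if and only if both $\mathcal{C}$ and its dual category $\mathcal{C}^{\mathrm{op}}$ are subtractive.
   Context: A category is pointed if it has a terminal object and an initial object and these coincide (a zero object); $0$ denotes the zero morphism between any two objects. Subtractive category: a pointed category $\mathcal{C}$ with binary products is subtractive if for any object $A$ and any monomorphism (subobject) $r:R\to A\times A$ the following holds: if there exist morphisms $f_1,f_2:A\to R$ with $rf_1=(1_A,1_A)$ and $rf_2=(1_A,0)$, then there exists a morphism $f_3:A\to R$ with $rf_3=(0,1_A)$. Accordingly, for a pointed category $\mathcal{C}$ with binary sums, $\mathcal{C}^{\mathrm{op}}$ is subtractive when for any object $A$ and any epimorphism $q:A+A\to Q$ in $\mathcal{C}$: if the morphisms $A+A\to A$ with components $1_A,1_A$ and with components $1_A,0$ both factor through $q$, then the morphism $A+A\to A$ with components $0,1_A$ factors through $q$. A category with finite products is additive if it is enriched in the category of abelian groups; equivalently, each object is equipped with an internal abelian group structure so that each morphism is a homomorphism of internal abelian groups. *)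

theory Defs
  imports "HOL-Algebra.Group"
begin

section \<open>Categories and duals\<close>

text \<open>
  A category is given by sets of objects and arrows inside two ambient types. Composition
  \<open>g \<cdot>\<^bsub>C\<^esub> f\<close> is ``\<open>g\<close> after \<open>f\<close>'' and is constrained only for composable arrows.
\<close>

record ('o, 'm) cat =
  Obj :: "'o set"
  Arr :: "'m set"
  Dom :: "'m \<Rightarrow> 'o"
  Cod :: "'m \<Rightarrow> 'o"
  Id :: "'o \<Rightarrow> 'm"
  Comp :: "'m \<Rightarrow> 'm \<Rightarrow> 'm"  (infixr "\<cdot>\<index>" 75)

definition Hom :: "('o, 'm) cat \<Rightarrow> 'o \<Rightarrow> 'o \<Rightarrow> 'm set" where
  "Hom C A B = {f \<in> Arr C. Dom C f = A \<and> Cod C f = B}"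

locale category =
  fixes C :: "('o, 'm) cat" (structure)
  assumes Dom_Obj: "f \<in> Arr C \<Longrightarrow> Dom C f \<in> Obj C"
    and Cod_Obj: "f \<in> Arr C \<Longrightarrow> Cod C f \<in> Obj C"
    and Id_Hom: "A \<in> Obj C \<Longrightarrow> Id C A \<in> Hom C A A"
    and Comp_Hom: "\<lbrakk>f \<in> Hom C A B; g \<in> Hom C B D\<rbrakk> \<Longrightarrow> g \<cdot> f \<in> Hom C A D"
    and Comp_Id_left: "f \<in> Hom C A B \<Longrightarrow> Id C B \<cdot> f = f"
    and Comp_Id_right: "f \<in> Hom C A B \<Longrightarrow> f \<cdot> Id C A = f"
    and Comp_assoc:
      "\<lbrakk>f \<in> Hom C A B; g \<in> Hom C B D; h \<in> Hom C D E\<rbrakk> \<Longrightarrow> (h \<cdot> g) \<cdot> f = h \<cdot> (g \<cdot> f)"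

definition op_cat :: "('o, 'm) cat \<Rightarrow> ('o, 'm) cat" where
  "op_cat C = \<lparr>Obj = Obj C, Arr = Arr C, Dom = Cod C, Cod = Dom C, Id = Id C,
                 Comp = (\<lambda>g f. f \<cdot>\<^bsub>C\<^esub> g)\<rparr>"

definition mono_arr :: "('o, 'm) cat \<Rightarrow> 'm \<Rightarrow> bool" where
  "mono_arr C m \<longleftrightarrow> m \<in> Arr C \<and>
     (\<forall>A. \<forall>g \<in> Hom C A (Dom C m). \<forall>h \<in> Hom C A (Dom C m).
        m \<cdot>\<^bsub>C\<^esub> g = m \<cdot>\<^bsub>C\<^esub> h \<longrightarrow> g = h)"

definition epi_arr :: "('o, 'm) cat \<Rightarrow> 'm \<Rightarrow> bool" where
  "epi_arr C e \<longleftrightarrow> e \<in> Arr C \<and>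
     (\<forall>B. \<forall>g \<in> Hom C (Cod C e) B. \<forall>h \<in> Hom C (Cod C e) B.
        g \<cdot>\<^bsub>C\<^esub> e = h \<cdot>\<^bsub>C\<^esub> e \<longrightarrow> g = h)"

definition has_mono_epi_factorizations :: "('o, 'm) cat \<Rightarrow> bool" where
  "has_mono_epi_factorizations C \<longleftrightarrow>
     (\<forall>f \<in> Arr C. \<exists>m e. mono_arr C m \<and> epi_arr C e \<and>
        Cod C e = Dom C m \<and> f = m \<cdot>\<^bsub>C\<^esub> e)"

section \<open>Zero objects and zero morphisms\<close>

definition terminal_obj :: "('o, 'm) cat \<Rightarrow> 'o \<Rightarrow> bool" where
  "terminal_obj C T \<longleftrightarrow> T \<in> Obj C \<and> (\<forall>A \<in> Obj C. \<exists>!f. f \<in> Hom C A T)"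

definition initial_obj :: "('o, 'm) cat \<Rightarrow> 'o \<Rightarrow> bool" where
  "initial_obj C I \<longleftrightarrow> I \<in> Obj C \<and> (\<forall>A \<in> Obj C. \<exists>!f. f \<in> Hom C I A)"

definition zero_obj :: "('o, 'm) cat \<Rightarrow> 'o \<Rightarrow> bool" where
  "zero_obj C Z \<longleftrightarrow> terminal_obj C Z \<and> initial_obj C Z"

definition pointed :: "('o, 'm) cat \<Rightarrow> bool" where
  "pointed C \<longleftrightarrow> (\<exists>Z. zero_obj C Z)"

definition zero_arr :: "('o, 'm) cat \<Rightarrow> 'o \<Rightarrow> 'o \<Rightarrow> 'm" where
  "zero_arr C A B =
     (THE f. \<exists>Z. zero_obj C Z \<and> (\<exists>g \<in> Hom C A Z. \<exists>h \<in> Hom C Z B. f = h \<cdot>\<^bsub>C\<^esub> g))"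

section \<open>Binary products and sums, finite products\<close>

definition binary_product :: "('o, 'm) cat \<Rightarrow> 'o \<Rightarrow> 'o \<Rightarrow> 'o \<Rightarrow> 'm \<Rightarrow> 'm \<Rightarrow> bool" where
  "binary_product C A B P p q \<longleftrightarrow> P \<in> Obj C \<and> p \<in> Hom C P A \<and> q \<in> Hom C P B \<and>
     (\<forall>X. \<forall>f \<in> Hom C X A. \<forall>g \<in> Hom C X B.
        \<exists>!h. h \<in> Hom C X P \<and> p \<cdot>\<^bsub>C\<^esub> h = f \<and> q \<cdot>\<^bsub>C\<^esub> h = g)"

definition binary_coproduct :: "('o, 'm) cat \<Rightarrow> 'o \<Rightarrow> 'o \<Rightarrow> 'o \<Rightarrow> 'm \<Rightarrow> 'm \<Rightarrow> bool" where
  "binary_coproduct C A B S i j \<longleftrightarrow> S \<in> Obj C \<and> i \<in> Hom C A S \<and> j \<in> Hom C B S \<and>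
     (\<forall>X. \<forall>f \<in> Hom C A X. \<forall>g \<in> Hom C B X.
        \<exists>!h. h \<in> Hom C S X \<and> h \<cdot>\<^bsub>C\<^esub> i = f \<and> h \<cdot>\<^bsub>C\<^esub> j = g)"

definition has_binary_products :: "('o, 'm) cat \<Rightarrow> bool" where
  "has_binary_products C \<longleftrightarrow>
     (\<forall>A \<in> Obj C. \<forall>B \<in> Obj C. \<exists>P p q. binary_product C A B P p q)"

definition has_binary_coproducts :: "('o, 'm) cat \<Rightarrow> bool" where
  "has_binary_coproducts C \<longleftrightarrow>
     (\<forall>A \<in> Obj C. \<forall>B \<in> Obj C. \<exists>S i j. binary_coproduct C A B S i j)"

text \<open>The arrow \<open>(f, g)\<close> into the product with projections \<open>p\<close> and \<open>q\<close>.\<close>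

definition pairing :: "('o, 'm) cat \<Rightarrow> 'm \<Rightarrow> 'm \<Rightarrow> 'm \<Rightarrow> 'm \<Rightarrow> 'm" where
  "pairing C p q f g =
     (THE h. h \<in> Hom C (Dom C f) (Dom C p) \<and> p \<cdot>\<^bsub>C\<^esub> h = f \<and> q \<cdot>\<^bsub>C\<^esub> h = g)"

definition product_of :: "('o, 'm) cat \<Rightarrow> 'i set \<Rightarrow> ('i \<Rightarrow> 'o) \<Rightarrow> 'o \<Rightarrow> ('i \<Rightarrow> 'm) \<Rightarrow> bool" where
  "product_of C I X P p \<longleftrightarrow> P \<in> Obj C \<and> (\<forall>i \<in> I. p i \<in> Hom C P (X i)) \<and>
     (\<forall>Y \<in> Obj C. \<forall>f. (\<forall>i \<in> I. f i \<in> Hom C Y (X i)) \<longrightarrow>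
        (\<exists>!h. h \<in> Hom C Y P \<and> (\<forall>i \<in> I. p i \<cdot>\<^bsub>C\<^esub> h = f i)))"

text \<open>Every finite index set is in bijection with a finite set of natural numbers.\<close>

definition has_finite_products :: "('o, 'm) cat \<Rightarrow> bool" where
  "has_finite_products C \<longleftrightarrow>
     (\<forall>(I :: nat set) X. finite I \<and> (\<forall>i \<in> I. X i \<in> Obj C) \<longrightarrow> (\<exists>P p. product_of C I X P p))"

section \<open>Finite limits\<close>

text \<open>A functor is given by its actions \<open>F\<close> on objects and \<open>\<phi>\<close> on arrows.\<close>

definition cat_functor ::
  "('i, 'a) cat \<Rightarrow> ('o, 'm) cat \<Rightarrow> ('i \<Rightarrow> 'o) \<Rightarrow> ('a \<Rightarrow> 'm) \<Rightarrow> bool" where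
  "cat_functor J C F \<phi> \<longleftrightarrow> category J \<and> category C \<and>
     (\<forall>i \<in> Obj J. F i \<in> Obj C \<and> \<phi> (Id J i) = Id C (F i)) \<and>
     (\<forall>u \<in> Arr J. \<phi> u \<in> Hom C (F (Dom J u)) (F (Cod J u))) \<and>
     (\<forall>u \<in> Arr J. \<forall>v \<in> Arr J. Cod J u = Dom J v \<longrightarrow>
        \<phi> (v \<cdot>\<^bsub>J\<^esub> u) = \<phi> v \<cdot>\<^bsub>C\<^esub> \<phi> u)"

definition cone ::
  "('i, 'a) cat \<Rightarrow> ('o, 'm) cat \<Rightarrow> ('i \<Rightarrow> 'o) \<Rightarrow> ('a \<Rightarrow> 'm) \<Rightarrow> 'o \<Rightarrow> ('i \<Rightarrow> 'm) \<Rightarrow> bool" where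
  "cone J C F \<phi> L p \<longleftrightarrow> L \<in> Obj C \<and> (\<forall>i \<in> Obj J. p i \<in> Hom C L (F i)) \<and>
     (\<forall>u \<in> Arr J. \<phi> u \<cdot>\<^bsub>C\<^esub> p (Dom J u) = p (Cod J u))"

definition limit_cone ::
  "('i, 'a) cat \<Rightarrow> ('o, 'm) cat \<Rightarrow> ('i \<Rightarrow> 'o) \<Rightarrow> ('a \<Rightarrow> 'm) \<Rightarrow> 'o \<Rightarrow> ('i \<Rightarrow> 'm) \<Rightarrow> bool" where
  "limit_cone J C F \<phi> L p \<longleftrightarrow> cone J C F \<phi> L p \<and>
     (\<forall>M q. cone J C F \<phi> M q \<longrightarrow>
        (\<exists>!h. h \<in> Hom C M L \<and> (\<forall>i \<in> Obj J. p i \<cdot>\<^bsub>C\<^esub> h = q i)))"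

text \<open>
  Every finite category is isomorphic to one whose objects and arrows are natural numbers,
  so it suffices to let the diagram shapes range over those.
\<close>

definition finitely_complete :: "('o, 'm) cat \<Rightarrow> bool" where
  "finitely_complete C \<longleftrightarrow>
     (\<forall>(J :: (nat, nat) cat) F \<phi>. finite (Obj J) \<and> finite (Arr J) \<and> cat_functor J C F \<phi> \<longrightarrow>
        (\<exists>L p. limit_cone J C F \<phi> L p))"

section \<open>Subtractive and additive categories\<close>

text \<open>
  The condition ranges over every product diagram \<open>(P, p, q)\<close> of \<open>A\<close> with itself; as products
  are unique up to isomorphism, this does not depend on a choice of \<open>A \<times> A\<close>.
\<close>

definition subtractive :: "('o, 'm) cat \<Rightarrow> bool" where
  "subtractive C \<longleftrightarrow> category C \<and> pointed C \<and> has_binary_products C \<and>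
     (\<forall>A \<in> Obj C. \<forall>P p q R r.
        binary_product C A A P p q \<and> mono_arr C r \<and> r \<in> Hom C R P \<and>
        (\<exists>f1 \<in> Hom C A R. r \<cdot>\<^bsub>C\<^esub> f1 = pairing C p q (Id C A) (Id C A)) \<and>
        (\<exists>f2 \<in> Hom C A R. r \<cdot>\<^bsub>C\<^esub> f2 = pairing C p q (Id C A) (zero_arr C A A)) \<longrightarrow>
        (\<exists>f3 \<in> Hom C A R. r \<cdot>\<^bsub>C\<^esub> f3 = pairing C p q (zero_arr C A A) (Id C A)))"

text \<open>
  Enrichment in abelian groups: every hom-set underlies an abelian group \<open>H A B\<close> (written
  multiplicatively, as in the library) and composition is a homomorphism in each argument.
\<close>

definition ab_enrichment :: "('o, 'm) cat \<Rightarrow> ('o \<Rightarrow> 'o \<Rightarrow> 'm monoid) \<Rightarrow> bool" where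
  "ab_enrichment C H \<longleftrightarrow>
     (\<forall>A \<in> Obj C. \<forall>B \<in> Obj C. comm_group (H A B) \<and> carrier (H A B) = Hom C A B) \<and>
     (\<forall>A \<in> Obj C. \<forall>B \<in> Obj C. \<forall>D \<in> Obj C.
        (\<forall>g \<in> Hom C B D. (\<lambda>f. g \<cdot>\<^bsub>C\<^esub> f) \<in> hom (H A B) (H A D)) \<and>
        (\<forall>f \<in> Hom C A B. (\<lambda>g. g \<cdot>\<^bsub>C\<^esub> f) \<in> hom (H B D) (H A D)))"

definition additive_category :: "('o, 'm) cat \<Rightarrow> bool" where
  "additive_category C \<longleftrightarrow>
     category C \<and> has_finite_products C \<and> (\<exists>H. ab_enrichment C H)"

section \<open>Basic facts\<close>

lemma op_cat_simps [simp]: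
  "Obj (op_cat C) = Obj C" "Arr (op_cat C) = Arr C"
  "Dom (op_cat C) = Cod C" "Cod (op_cat C) = Dom C"
  "Id (op_cat C) = Id C" "g \<cdot>\<^bsub>op_cat C\<^esub> f = f \<cdot>\<^bsub>C\<^esub> g"
  "Hom (op_cat C) A B = Hom C B A"
  by (auto simp: op_cat_def Hom_def)

lemma op_op_cat [simp]: "op_cat (op_cat C) = C"
  by (simp add: op_cat_def)

lemma category_op_cat: "category C \<Longrightarrow> category (op_cat C)"
proof -
  assume "category C"
  then interpret category C .
  show ?thesis
    by (rule category.intro; simp only: op_cat_simps;
        (rule Dom_Obj Cod_Obj Id_Hom Comp_Hom Comp_Id_left Comp_Id_right Comp_assoc[symmetric];
         assumption))
qed

lemma mono_arr_op_cat: "mono_arr (op_cat C) m \<longleftrightarrow> epi_arr C m"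
  by (simp add: mono_arr_def epi_arr_def)

lemma binary_product_op_cat: "binary_product (op_cat C) A B P p q \<longleftrightarrow> binary_coproduct C A B P p q"
  by (simp add: binary_product_def binary_coproduct_def)

lemma zero_obj_op_cat: "zero_obj (op_cat C) Z \<longleftrightarrow> zero_obj C Z"
  by (auto simp: zero_obj_def terminal_obj_def initial_obj_def)

lemma zero_arr_op_cat: "zero_arr (op_cat C) A B = zero_arr C B A"
  unfolding zero_arr_def zero_obj_op_cat op_cat_simps by (rule arg_cong[where f = The], rule ext) blast

lemma pairing_eq:
  assumes "binary_product C A B P p q" "f \<in> Hom C X A" "g \<in> Hom C X B"
    and "h \<in> Hom C X P" "p \<cdot>\<^bsub>C\<^esub> h = f" "q \<cdot>\<^bsub>C\<^esub> h = g"
  shows "pairing C p q f g = h"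
proof -
  have dom: "Dom C f = X" "Dom C p = P"
    using assms by (auto simp: Hom_def binary_product_def)
  have ex1: "\<exists>!h. h \<in> Hom C X P \<and> p \<cdot>\<^bsub>C\<^esub> h = f \<and> q \<cdot>\<^bsub>C\<^esub> h = g"
    using assms(1-3) unfolding binary_product_def by blast
  show ?thesis
    unfolding pairing_def dom
    by (rule the1_equality[OF ex1]) (simp add: assms(4-6))
qed

lemma (in category) zero_arr_eq:
  assumes "zero_obj C Z" "g \<in> Hom C A Z" "h \<in> Hom C Z B"
  shows "zero_arr C A B = h \<cdot> g"
proof -
  have AB: "A \<in> Obj C" "B \<in> Obj C"
    using assms(2,3) Dom_Obj[of g] Cod_Obj[of h] by (simp_all add: Hom_def)
  have unique: "h' \<cdot> g' = h \<cdot> g"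
    if Z': "zero_obj C Z'" and g': "g' \<in> Hom C A Z'" and h': "h' \<in> Hom C Z' B" for Z' g' h'
  proof -
    have ZZ': "\<exists>!x. x \<in> Hom C Z Z'"
      using Z' assms(1) by (simp add: zero_obj_def terminal_obj_def initial_obj_def)
    then obtain k where k: "k \<in> Hom C Z Z'"
      by (rule ex1E)
    have AZ': "\<exists>!x. x \<in> Hom C A Z'" and ZB: "\<exists>!x. x \<in> Hom C Z B"
      using Z' assms(1) AB by (simp_all add: zero_obj_def terminal_obj_def initial_obj_def)
    have "k \<cdot> g = g'"
      using AZ' Comp_Hom[OF assms(2) k] g' by (auto elim!: ex1E)
    moreover have "h' \<cdot> k = h"
      using ZB Comp_Hom[OF k h'] assms(3) by (auto elim!: ex1E)
    ultimately show ?thesis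
      using Comp_assoc[OF assms(2) k h'] by simp
  qed
  show ?thesis
    unfolding zero_arr_def
  proof (rule the_equality)
    show "\<exists>Z. zero_obj C Z \<and> (\<exists>g' \<in> Hom C A Z. \<exists>h' \<in> Hom C Z B. h \<cdot> g = h' \<cdot> g')"
      using assms by blast
  next
    fix f
    assume "\<exists>Z. zero_obj C Z \<and> (\<exists>g \<in> Hom C A Z. \<exists>h \<in> Hom C Z B. f = h \<cdot> g)"
    then obtain Z' g' h' where "zero_obj C Z'" "g' \<in> Hom C A Z'" "h' \<in> Hom C Z' B" "f = h' \<cdot> g'"
      by (elim exE conjE bexE)
    then show "f = h \<cdot> g"
      using unique by simp
  qed
qed

end

theory Submission
  imports Defs
begin

text \<open>
  Let \<open>Q \<subseteq> A \<times> A\<close> be the image of the map \<open>A + A \<rightarrow> A \<times> A\<close> with components \<open>(1, 1)\<close> and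
  \<open>(1, 0)\<close>. Subtractivity of \<open>C\<close> gives \<open>(0, 1) \<in> Q\<close>; subtractivity of the dual gives
  \<open>s : Q \<rightarrow> A\<close> with \<open>s(x, x) = 0\<close> and \<open>s(x, 0) = x\<close>, a partial subtraction. Applying
  subtractivity of \<open>C\<close> to relations defined from \<open>Q\<close> and \<open>s\<close> shows that \<open>n = s(0, 1)\<close> is an
  involution and that \<open>(n x, y) \<in> Q\<close> for all \<open>x, y\<close>, whence \<open>Q = A \<times> A\<close>. So \<open>s\<close> is a total
  subtraction, and \<open>(1, 1)\<close>, \<open>(1, 0)\<close> are jointly epic into \<open>A \<times> A\<close>, which makes every arrow
  (in particular every \<open>s\<close>) a homomorphism for it; such a subtraction comes from an abelian
  group. Conversely, in the additive case the third factorization is \<open>f1 - f2\<close>.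
\<close>

section \<open>Calculus of composition, zero arrows and pairings\<close>

context category
begin

text \<open>The hom-set axioms mention intermediate objects that a rewriter would have to guess.
  Here they are recast with \<open>Dom\<close> and \<open>Cod\<close> side conditions; collected in
  \<open>cat_simps\<close>, they nest composites to the right.\<close>

lemma comp_closed:
  assumes "f \<in> Arr C" "g \<in> Arr C" "Dom C g = Cod C f"
  shows "g \<cdot> f \<in> Arr C" "Dom C (g \<cdot> f) = Dom C f" "Cod C (g \<cdot> f) = Cod C g"
  using Comp_Hom[of f "Dom C f" "Cod C f" g "Cod C g"] assms by (auto simp: Hom_def)

lemma comp_assoc:
  assumes "f \<in> Arr C" "g \<in> Arr C" "h \<in> Arr C" "Dom C g = Cod C f" "Dom C h = Cod C g"
  shows "(h \<cdot> g) \<cdot> f = h \<cdot> (g \<cdot> f)"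
  using Comp_assoc[of f "Dom C f" "Cod C f" g "Cod C g" h "Cod C h"] assms by (auto simp: Hom_def)

lemma comp_id_left: "f \<in> Arr C \<Longrightarrow> Cod C f = A \<Longrightarrow> Id C A \<cdot> f = f"
  using Comp_Id_left[of f "Dom C f" A] by (simp add: Hom_def)

lemma comp_id_right: "f \<in> Arr C \<Longrightarrow> Dom C f = A \<Longrightarrow> f \<cdot> Id C A = f"
  using Comp_Id_right[of f A "Cod C f"] by (simp add: Hom_def)

lemma id_closed:
  assumes "A \<in> Obj C"
  shows "Id C A \<in> Arr C" "Dom C (Id C A) = A" "Cod C (Id C A) = A"
  using Id_Hom[OF assms] by (auto simp: Hom_def)

lemmas cat_simps = comp_closed comp_assoc comp_id_left comp_id_right id_closed Dom_Obj Cod_Obj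

lemma zero_closed:
  assumes "pointed C" "A \<in> Obj C" "B \<in> Obj C"
  shows "zero_arr C A B \<in> Arr C" "Dom C (zero_arr C A B) = A" "Cod C (zero_arr C A B) = B"
proof -
  obtain Z where Z: "zero_obj C Z"
    using assms(1) by (auto simp: pointed_def)
  obtain g h where gh: "g \<in> Hom C A Z" "h \<in> Hom C Z B"
    using Z assms(2,3) by (force simp: zero_obj_def terminal_obj_def initial_obj_def)
  show "zero_arr C A B \<in> Arr C" "Dom C (zero_arr C A B) = A" "Cod C (zero_arr C A B) = B"
    using Comp_Hom[OF gh] zero_arr_eq[OF Z gh] by (auto simp: Hom_def)
qed

lemma comp_zero:
  assumes "pointed C" "f \<in> Arr C" "A \<in> Obj C" "Dom C f = B"
  shows "f \<cdot> zero_arr C A B = zero_arr C A (Cod C f)"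
proof -
  obtain Z where Z: "zero_obj C Z"
    using assms(1) by (auto simp: pointed_def)
  have B: "B \<in> Obj C" using assms Dom_Obj by blast
  obtain g h where gh: "g \<in> Hom C A Z" "h \<in> Hom C Z B"
    using Z assms(3) B by (force simp: zero_obj_def terminal_obj_def initial_obj_def)
  have f: "f \<in> Hom C B (Cod C f)" using assms by (simp add: Hom_def)
  show ?thesis
    using zero_arr_eq[OF Z gh] zero_arr_eq[OF Z gh(1) Comp_Hom[OF gh(2) f]] Comp_assoc[OF gh f]
    by simp
qed

lemma zero_comp:
  assumes "pointed C" "f \<in> Arr C" "A \<in> Obj C" "Cod C f = B"
  shows "zero_arr C B A \<cdot> f = zero_arr C (Dom C f) A"
proof -
  obtain Z where Z: "zero_obj C Z"
    using assms(1) by (auto simp: pointed_def)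
  have B: "B \<in> Obj C" using assms Cod_Obj by blast
  obtain g h where gh: "g \<in> Hom C B Z" "h \<in> Hom C Z A"
    using Z assms(3) B by (force simp: zero_obj_def terminal_obj_def initial_obj_def)
  have f: "f \<in> Hom C (Dom C f) B" using assms by (simp add: Hom_def)
  show ?thesis
    using zero_arr_eq[OF Z gh] zero_arr_eq[OF Z Comp_Hom[OF f gh(1)] gh(2)] Comp_assoc[OF f gh]
    by simp
qed

lemma pairing_props:
  assumes "binary_product C A B P p q" "f \<in> Hom C X A" "g \<in> Hom C X B"
  shows "pairing C p q f g \<in> Hom C X P" "p \<cdot> pairing C p q f g = f" "q \<cdot> pairing C p q f g = g"
proof -
  obtain h where h: "h \<in> Hom C X P" "p \<cdot> h = f" "q \<cdot> h = g"
    using assms unfolding binary_product_def by blast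
  show "pairing C p q f g \<in> Hom C X P" "p \<cdot> pairing C p q f g = f" "q \<cdot> pairing C p q f g = g"
    using pairing_eq[OF assms h] h by auto
qed

lemma product_arr_eqI:
  assumes "binary_product C A B P p q" "f \<in> Hom C X P" "g \<in> Hom C X P"
    and "p \<cdot> f = p \<cdot> g" "q \<cdot> f = q \<cdot> g"
  shows "f = g"
proof -
  have "p \<cdot> f \<in> Hom C X A" "q \<cdot> f \<in> Hom C X B"
    using assms Comp_Hom unfolding binary_product_def by blast+
  then have "\<exists>!h. h \<in> Hom C X P \<and> p \<cdot> h = p \<cdot> f \<and> q \<cdot> h = q \<cdot> f"
    using assms(1) unfolding binary_product_def by blast
  then show ?thesis
    using assms(2-5) by (auto elim!: ex1E)
qed

section \<open>Finite products and equalizers from finite limits\<close>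

lemma finite_products_of_limits:
  assumes "finitely_complete C"
  shows "has_finite_products C"
  unfolding has_finite_products_def
proof (intro allI impI)
  fix I :: "nat set" and X
  assume I: "finite I \<and> (\<forall>i \<in> I. X i \<in> Obj C)"
  \<comment> \<open>The discrete category on \<open>I\<close>: the arrow \<open>i\<close> is the
    identity of the object \<open>i\<close>, so a cone is merely a family of arrows.\<close>
  define J :: "(nat, nat) cat" where
    "J = \<lparr>Obj = I, Arr = I, Dom = id, Cod = id, Id = id, Comp = (\<lambda>g f. g)\<rparr>"
  have J: "category J"
    by unfold_locales (auto simp: J_def Hom_def)
  have "cat_functor J C X (\<lambda>i. Id C (X i))"
    unfolding cat_functor_def using J I category_axioms Id_Hom
    by (auto simp: J_def id_closed cat_simps)
  then obtain L p where "limit_cone J C X (\<lambda>i. Id C (X i)) L p"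
    using assms I unfolding finitely_complete_def by (force simp: J_def)
  moreover have "cone J C X (\<lambda>i. Id C (X i)) M q \<longleftrightarrow> M \<in> Obj C \<and> (\<forall>i \<in> I. q i \<in> Hom C M (X i))"
    for M q
    by (auto simp: cone_def J_def Comp_Id_left)
  ultimately have "product_of C I X L p"
    by (auto simp: limit_cone_def product_of_def J_def)
  then show "\<exists>P p. product_of C I X P p" by blast
qed

lemma binary_products_of_finite:
  assumes "has_finite_products C"
  shows "has_binary_products C"
  unfolding has_binary_products_def
proof (intro ballI)
  fix A B assume AB: "A \<in> Obj C" "B \<in> Obj C"
  define X where "X = (\<lambda>i::nat. if i = 0 then A else B)"
  have "finite {0, 1::nat} \<and> (\<forall>i \<in> {0, 1}. X i \<in> Obj C)"
    using AB by (simp add: X_def)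
  then obtain P p where "product_of C {0, 1} X P p"
    using assms unfolding has_finite_products_def by meson
  then have P: "P \<in> Obj C" "p 0 \<in> Hom C P A" "p 1 \<in> Hom C P B"
    and U: "\<And>Y f. Y \<in> Obj C \<Longrightarrow> f 0 \<in> Hom C Y A \<Longrightarrow> f 1 \<in> Hom C Y B \<Longrightarrow>
      \<exists>!h. h \<in> Hom C Y P \<and> p 0 \<cdot> h = f (0::nat) \<and> p 1 \<cdot> h = f 1"
    by (simp_all add: product_of_def X_def)
  have "\<exists>!h. h \<in> Hom C Y P \<and> p 0 \<cdot> h = f \<and> p 1 \<cdot> h = g"
    if "f \<in> Hom C Y A" "g \<in> Hom C Y B" for Y f g
    using U[of Y "\<lambda>i. if i = 0 then f else g"] that Dom_Obj[of f] by (simp add: Hom_def)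
  with P have "binary_product C A B P (p 0) (p 1)"
    by (simp add: binary_product_def)
  then show "\<exists>P p q. binary_product C A B P p q" by blast
qed

lemma equalizer_ex:
  assumes "finitely_complete C" "u \<in> Hom C D T" "v \<in> Hom C D T"
  obtains E e where "e \<in> Hom C E D" "u \<cdot> e = v \<cdot> e"
    "\<And>X x. x \<in> Hom C X D \<Longrightarrow> u \<cdot> x = v \<cdot> x \<Longrightarrow> \<exists>!y. y \<in> Hom C X E \<and> e \<cdot> y = x"
proof -
  \<comment> \<open>The parallel pair: arrows 0 and 1 are the identities of the objects 0 and 1,
    while 2 and 3 run from 0 to 1. In \<open>Comp\<close>, \<open>g < 2\<close> means that
    \<open>g\<close> is an identity; otherwise a composable \<open>f\<close> is the identity
    0.\<close>
  define J :: "(nat, nat) cat" where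
    "J = \<lparr>Obj = {0, 1}, Arr = {0, 1, 2, 3}, Dom = (\<lambda>a. if a = 1 then 1 else 0),
       Cod = (\<lambda>a. if a = 0 then 0 else 1), Id = id,
       Comp = (\<lambda>g f. if g < 2 then f else g)\<rparr>"
  define F where "F = (\<lambda>i::nat. if i = 0 then D else T)"
  define \<phi> where "\<phi> = (\<lambda>a::nat. if a = 0 then Id C D else if a = 1 then Id C T
    else if a = 2 then u else v)"
  have DT: "D \<in> Obj C" "T \<in> Obj C"
    using assms(2) Dom_Obj Cod_Obj by (auto simp: Hom_def)
  have J: "category J"
  proof
    show "g \<cdot>\<^bsub>J\<^esub> f \<in> Hom J A D" if "f \<in> Hom J A B" "g \<in> Hom J B D" for f g A B D
      using that by (cases "g < 2"; cases "f < 2") (auto simp: J_def Hom_def)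
  qed (auto simp: J_def Hom_def)
  have "cat_functor J C F \<phi>"
    unfolding cat_functor_def using J DT category_axioms assms(2,3)
    by (auto simp: J_def F_def \<phi>_def Hom_def cat_simps)
  then obtain L p where L: "limit_cone J C F \<phi> L p"
    using assms(1) unfolding finitely_complete_def by (force simp: J_def)
  have cone: "cone J C F \<phi> M q \<longleftrightarrow> M \<in> Obj C \<and> q 0 \<in> Hom C M D \<and> q 1 \<in> Hom C M T \<and>
      u \<cdot> q 0 = q 1 \<and> v \<cdot> q 0 = q 1" for M q
    using DT by (auto simp: cone_def J_def F_def \<phi>_def Comp_Id_left)
  have e: "p 0 \<in> Hom C L D" "u \<cdot> p 0 = p 1" "v \<cdot> p 0 = p 1"
    using L cone by (auto simp: limit_cone_def)
  have "\<exists>!y. y \<in> Hom C X L \<and> p 0 \<cdot> y = x" if x: "x \<in> Hom C X D" "u \<cdot> x = v \<cdot> x" for X x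
  proof -
    have "cone J C F \<phi> X (\<lambda>i. if i = 0 then x else u \<cdot> x)"
      using x assms by (auto simp: cone Comp_Hom Hom_def Dom_Obj cat_simps)
    then have "\<exists>!h. h \<in> Hom C X L \<and>
        (\<forall>i \<in> Obj J. p i \<cdot> h = (if i = 0 then x else u \<cdot> x))"
      using L unfolding limit_cone_def by blast
    then have "\<exists>!h. h \<in> Hom C X L \<and> p 0 \<cdot> h = x \<and> p 1 \<cdot> h = u \<cdot> x"
      by (simp add: J_def)
    \<comment> \<open>The leg at object 1 is forced by the leg at object 0, so existence and
      uniqueness concern \<open>p 0\<close> alone.\<close>
    moreover have "p 1 \<cdot> h = u \<cdot> x" if "h \<in> Hom C X L" "p 0 \<cdot> h = x" for h
      using that e(1,2) assms(2) Comp_assoc[of h X L "p 0" D u T] by simp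
    ultimately show ?thesis by metis
  qed
  then show thesis
    using that e by metis
qed

text \<open>Equalizers are taken one after another by induction on \<open>F\<close>: each new pair
  is equalized after restriction along the equalizer of the earlier ones. Each pair may have a
  codomain of its own.\<close>

lemma finite_equalizer_ex:
  assumes "finitely_complete C" "finite F" "D \<in> Obj C"
    and "\<forall>(u, v) \<in> F. \<exists>T. u \<in> Hom C D T \<and> v \<in> Hom C D T"
  shows "\<exists>E e. e \<in> Hom C E D \<and> (\<forall>(u, v) \<in> F. u \<cdot> e = v \<cdot> e) \<and>
    (\<forall>X. \<forall>x \<in> Hom C X D. (\<forall>(u, v) \<in> F. u \<cdot> x = v \<cdot> x) \<longrightarrow>
      (\<exists>!y. y \<in> Hom C X E \<and> e \<cdot> y = x))"
  using assms(2,4)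
proof (induction F)
  case empty
  have "Id C D \<in> Hom C D D" "\<forall>X. \<forall>x \<in> Hom C X D. \<exists>!y. y \<in> Hom C X D \<and> Id C D \<cdot> y = x"
    using assms(3) Id_Hom Comp_Id_left by (auto simp: Comp_Id_left)
  then show ?case by blast
next
  case (insert uv F)
  obtain u v where uv: "uv = (u, v)" by force
  obtain E e where e: "e \<in> Hom C E D" "\<forall>(u, v) \<in> F. u \<cdot> e = v \<cdot> e"
    and U: "\<And>X x. x \<in> Hom C X D \<Longrightarrow> (\<forall>(u, v) \<in> F. u \<cdot> x = v \<cdot> x) \<Longrightarrow>
      \<exists>!y. y \<in> Hom C X E \<and> e \<cdot> y = x"
    using insert.IH insert.prems by (auto simp: Ball_def)
  obtain T where T: "u \<in> Hom C D T" "v \<in> Hom C D T"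
    using insert.prems uv by blast
  obtain E' e' where e': "e' \<in> Hom C E' E" "(u \<cdot> e) \<cdot> e' = (v \<cdot> e) \<cdot> e'"
    and U': "\<And>X x. x \<in> Hom C X E \<Longrightarrow> (u \<cdot> e) \<cdot> x = (v \<cdot> e) \<cdot> x \<Longrightarrow>
      \<exists>!y. y \<in> Hom C X E' \<and> e' \<cdot> y = x"
    by (rule equalizer_ex[OF assms(1) Comp_Hom[OF e(1) T(1)] Comp_Hom[OF e(1) T(2)]]) (rule that)
  have assoc: "(w \<cdot> e) \<cdot> x = w \<cdot> (e \<cdot> x)" if "w \<in> Hom C D S" "x \<in> Hom C X E" for w S x X
    using Comp_assoc[OF that(2) e(1) that(1)] .
  have eq: "a \<cdot> (e \<cdot> e') = b \<cdot> (e \<cdot> e')" if ab: "(a, b) \<in> insert uv F" for a b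
  proof -
    obtain S where S: "a \<in> Hom C D S" "b \<in> Hom C D S"
      using bspec[OF insert.prems ab] by auto
    have "(a \<cdot> e) \<cdot> e' = (b \<cdot> e) \<cdot> e'"
    proof (cases "(a, b) \<in> F")
      case True
      then show ?thesis using bspec[OF e(2) True] by simp
    next
      case False
      then show ?thesis using ab uv e'(2) by simp
    qed
    then show ?thesis
      using assoc[OF S(1) e'(1)] assoc[OF S(2) e'(1)] by simp
  qed
  have "\<exists>!y. y \<in> Hom C X E' \<and> (e \<cdot> e') \<cdot> y = x"
    if x: "x \<in> Hom C X D" "\<forall>(u, v) \<in> insert uv F. u \<cdot> x = v \<cdot> x" for X x
  proof -
    obtain y where y: "y \<in> Hom C X E" "e \<cdot> y = x" "\<And>y'. y' \<in> Hom C X E \<Longrightarrow> e \<cdot> y' = x \<Longrightarrow> y' = y"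
      using U[OF x(1)] x(2) by (auto elim!: ex1E)
    have "(u \<cdot> e) \<cdot> y = (v \<cdot> e) \<cdot> y"
      using bspec[OF x(2), of uv] uv assoc[OF T(1) y(1)] assoc[OF T(2) y(1)]
      by (simp add: y(2))
    then obtain z where z: "z \<in> Hom C X E'" "e' \<cdot> z = y"
      "\<And>z'. z' \<in> Hom C X E' \<Longrightarrow> e' \<cdot> z' = y \<Longrightarrow> z' = z"
      using U'[OF y(1)] by (auto elim!: ex1E)
    have as: "(e \<cdot> e') \<cdot> w = e \<cdot> (e' \<cdot> w)" if "w \<in> Hom C X E'" for w
      using Comp_assoc[OF that e'(1) e(1)] .
    show ?thesis
    proof (rule ex1I[of _ z])
      show "z \<in> Hom C X E' \<and> (e \<cdot> e') \<cdot> z = x"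
        using z(1) as[OF z(1)] by (simp add: z(2) y(2))
      show "z' = z" if "z' \<in> Hom C X E' \<and> (e \<cdot> e') \<cdot> z' = x" for z'
      proof -
        have z': "z' \<in> Hom C X E'" "(e \<cdot> e') \<cdot> z' = x" using that by auto
        have "e' \<cdot> z' = y"
          by (rule y(3)[OF Comp_Hom[OF z'(1) e'(1)]]) (use z'(2) as[OF z'(1)] in simp)
        then show ?thesis by (rule z(3)[OF z'(1)])
      qed
    qed
  qed
  with eq Comp_Hom[OF e'(1) e(1)] show ?case
    by (intro exI[of _ E'] exI[of _ "e \<cdot> e'"] conjI allI ballI impI)
      (auto simp only: split_paired_all prod.case)
qed

end

section \<open>Subtractivity for relations given by spans\<close>

text \<open>A jointly monic span amounts to a monomorphism \<open>m\<close> into the product.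
  Phrased without the product, the property can be read in the dual category as one about jointly
  epic pairs.\<close>

lemma (in category) subtractive_jointly_monic:
  assumes sub: "subtractive C" and A: "A \<in> Obj C"
    and r: "r1 \<in> Hom C R A" "r2 \<in> Hom C R A"
    and mono: "\<And>X x y. x \<in> Hom C X R \<Longrightarrow> y \<in> Hom C X R \<Longrightarrow>
      r1 \<cdot> x = r1 \<cdot> y \<Longrightarrow> r2 \<cdot> x = r2 \<cdot> y \<Longrightarrow> x = y"
    and f: "f1 \<in> Hom C A R" "r1 \<cdot> f1 = Id C A" "r2 \<cdot> f1 = Id C A"
      "f2 \<in> Hom C A R" "r1 \<cdot> f2 = Id C A" "r2 \<cdot> f2 = zero_arr C A A"
  shows "\<exists>f3 \<in> Hom C A R. r1 \<cdot> f3 = zero_arr C A A \<and> r2 \<cdot> f3 = Id C A"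
proof -
  have pt: "pointed C" using sub by (simp add: subtractive_def)
  obtain P p q where P: "binary_product C A A P p q"
    using sub A unfolding subtractive_def has_binary_products_def by metis
  have pq: "p \<in> Hom C P A" "q \<in> Hom C P A"
    using P by (auto simp: binary_product_def)
  define m where "m = pairing C p q r1 r2"
  have m: "m \<in> Hom C R P" "p \<cdot> m = r1" "q \<cdot> m = r2"
    using pairing_props[OF P r] by (auto simp: m_def)
  have mx: "r1 \<cdot> x = p \<cdot> (m \<cdot> x)" "r2 \<cdot> x = q \<cdot> (m \<cdot> x)" if "x \<in> Hom C X R" for X x
    using m that pq Comp_assoc[OF that m(1)] by metis+
  have "mono_arr C m"
    unfolding mono_arr_def using m(1) mono mx by (auto simp: Hom_def)
  have z: "Id C A \<in> Hom C A A" "zero_arr C A A \<in> Hom C A A"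
    using A pt by (auto simp: Hom_def zero_closed id_closed)
  have "m \<cdot> f1 = pairing C p q (Id C A) (Id C A)"
    "m \<cdot> f2 = pairing C p q (Id C A) (zero_arr C A A)"
    using pairing_eq[OF P z(1) z(1) Comp_Hom[OF f(1) m(1)]]
      pairing_eq[OF P z(1) z(2) Comp_Hom[OF f(4) m(1)]] mx[OF f(1)] mx[OF f(4)] f by auto
  then obtain f3 where "f3 \<in> Hom C A R" "m \<cdot> f3 = pairing C p q (zero_arr C A A) (Id C A)"
    using sub A P \<open>mono_arr C m\<close> m(1) f(1,4) unfolding subtractive_def by metis
  then show ?thesis
    using mx[of f3 A] pairing_props[OF P z(2) z(1)] by auto
qed

text \<open>
  The finite set \<open>F\<close> of equations carves a relation on \<open>A\<close> out of the span \<open>(r1, r2)\<close>.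
\<close>

lemma (in category) subtractive_equations:
  assumes sub: "subtractive C" and fc: "finitely_complete C" and A: "A \<in> Obj C"
    and r: "r1 \<in> Hom C D A" "r2 \<in> Hom C D A"
    and F: "finite F" "\<forall>(u, v) \<in> F. \<exists>T. u \<in> Hom C D T \<and> v \<in> Hom C D T"
    and mono: "\<And>X x y. x \<in> Hom C X D \<Longrightarrow> y \<in> Hom C X D \<Longrightarrow>
      \<forall>(u, v) \<in> F. u \<cdot> x = v \<cdot> x \<Longrightarrow> \<forall>(u, v) \<in> F. u \<cdot> y = v \<cdot> y \<Longrightarrow>
      r1 \<cdot> x = r1 \<cdot> y \<Longrightarrow> r2 \<cdot> x = r2 \<cdot> y \<Longrightarrow> x = y"
    and d1: "d1 \<in> Hom C A D" "\<forall>(u, v) \<in> F. u \<cdot> d1 = v \<cdot> d1"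
      "r1 \<cdot> d1 = Id C A" "r2 \<cdot> d1 = Id C A"
    and d2: "d2 \<in> Hom C A D" "\<forall>(u, v) \<in> F. u \<cdot> d2 = v \<cdot> d2"
      "r1 \<cdot> d2 = Id C A" "r2 \<cdot> d2 = zero_arr C A A"
  shows "\<exists>d3 \<in> Hom C A D. (\<forall>(u, v) \<in> F. u \<cdot> d3 = v \<cdot> d3) \<and>
    r1 \<cdot> d3 = zero_arr C A A \<and> r2 \<cdot> d3 = Id C A"
proof -
  have D: "D \<in> Obj C" using r(1) Dom_Obj by (auto simp: Hom_def)
  obtain E e where e: "e \<in> Hom C E D" "\<forall>(u, v) \<in> F. u \<cdot> e = v \<cdot> e"
    and U': "\<forall>X. \<forall>x \<in> Hom C X D. (\<forall>(u, v) \<in> F. u \<cdot> x = v \<cdot> x) \<longrightarrow>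
      (\<exists>!y. y \<in> Hom C X E \<and> e \<cdot> y = x)"
    using finite_equalizer_ex[OF fc F(1) D F(2)] by (elim exE conjE) (rule that)
  note U = U'[THEN spec, THEN bspec, THEN mp]
  have ex: "e \<cdot> x \<in> Hom C X D" "(w \<cdot> e) \<cdot> x = w \<cdot> (e \<cdot> x)"
    if "x \<in> Hom C X E" "w \<in> Hom C D T" for X x w T
    using Comp_Hom[OF that(1) e(1)] Comp_assoc[OF that(1) e(1) that(2)] by auto
  have eF: "\<forall>(u, v) \<in> F. u \<cdot> (e \<cdot> x) = v \<cdot> (e \<cdot> x)" if x: "x \<in> Hom C X E" for X x
  proof clarify
    fix u v assume uv: "(u, v) \<in> F"
    then obtain T where "u \<in> Hom C D T" "v \<in> Hom C D T" using F(2) by blast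
    then have "u \<cdot> (e \<cdot> x) = (u \<cdot> e) \<cdot> x" "v \<cdot> (e \<cdot> x) = (v \<cdot> e) \<cdot> x"
      using ex(2)[OF x] by simp_all
    then show "u \<cdot> (e \<cdot> x) = v \<cdot> (e \<cdot> x)" using e(2) uv by auto
  qed
  obtain f1 where f1: "f1 \<in> Hom C A E" "e \<cdot> f1 = d1"
    using U[OF d1(1,2)] by blast
  obtain f2 where f2: "f2 \<in> Hom C A E" "e \<cdot> f2 = d2"
    using U[OF d2(1,2)] by blast
  \<comment> \<open>Restricted to the solution object \<open>E\<close> the span is jointly monic:
    \<open>mono\<close> compares solutions of \<open>F\<close> only, and \<open>e\<close> is monic
    by the uniqueness in \<open>U\<close>.\<close>
  have "\<exists>f3 \<in> Hom C A E. (r1 \<cdot> e) \<cdot> f3 = zero_arr C A A \<and> (r2 \<cdot> e) \<cdot> f3 = Id C A"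
  proof (rule subtractive_jointly_monic[OF sub A, of _ E _ f1 f2])
    show "r1 \<cdot> e \<in> Hom C E A" "r2 \<cdot> e \<in> Hom C E A"
      using Comp_Hom[OF e(1)] r by auto
    show "x = y" if x: "x \<in> Hom C X E" and y: "y \<in> Hom C X E"
      and xy: "(r1 \<cdot> e) \<cdot> x = (r1 \<cdot> e) \<cdot> y" "(r2 \<cdot> e) \<cdot> x = (r2 \<cdot> e) \<cdot> y" for X x y
    proof -
      have "e \<cdot> x = e \<cdot> y"
        using mono[OF ex(1)[OF x r(1)] ex(1)[OF y r(1)] eF[OF x] eF[OF y]] xy
          ex(2)[OF x] ex(2)[OF y] r by simp
      then show ?thesis
        using U[OF ex(1)[OF x r(1)] eF[OF x]] x y by (auto elim!: ex1E)
    qed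
  qed (use f1 f2 d1 d2 ex(2)[OF f1(1)] ex(2)[OF f2(1)] r in auto)
  then show ?thesis
    using ex r eF by metis
qed

section \<open>From a partial to a total subtraction\<close>

context category
begin

text \<open>Composites are kept nested to the right, so an equation for \<open>g \<cdot> f\<close>
  must also be available in front of a further arrow \<open>x\<close>.\<close>

lemma reassoc:
  "g \<cdot> f = k \<Longrightarrow> f \<in> Arr C \<Longrightarrow> g \<in> Arr C \<Longrightarrow> Dom C g = Cod C f \<Longrightarrow>
    x \<in> Arr C \<Longrightarrow> Cod C x = Dom C f \<Longrightarrow> g \<cdot> (f \<cdot> x) = k \<cdot> x"
  by (metis comp_assoc)

text \<open>Read \<open>q1\<close>, \<open>q2\<close> as a relation \<open>Q\<close> on
  \<open>A\<close> and \<open>s\<close> as a subtraction defined on it; \<open>e1\<close>,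
  \<open>e2\<close>, \<open>t\<close> put (x, x), (x, 0), (0, x) into \<open>Q\<close>. Two
  auxiliary relations, on \<open>A\<close> and on \<open>P\<close>, contain all (x, x) and (x, 0);
  the content lies in what it means for them to contain (0, x).\<close>

lemma subtraction_domain_total:
  assumes sub: "subtractive C" and fc: "finitely_complete C" and A: "A \<in> Obj C"
    and P: "binary_product C A A P p q"
    and q: "q1 \<in> Hom C Q A" "q2 \<in> Hom C Q A"
    and mono: "\<And>X x y. x \<in> Hom C X Q \<Longrightarrow> y \<in> Hom C X Q \<Longrightarrow>
      q1 \<cdot> x = q1 \<cdot> y \<Longrightarrow> q2 \<cdot> x = q2 \<cdot> y \<Longrightarrow> x = y"
    and e: "e1 \<in> Hom C A Q" "e2 \<in> Hom C A Q" "t \<in> Hom C A Q"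
    and s: "s \<in> Hom C Q A"
    and e1: "q1 \<cdot> e1 = Id C A" "q2 \<cdot> e1 = Id C A" "s \<cdot> e1 = zero_arr C A A"
    and e2: "q1 \<cdot> e2 = Id C A" "q2 \<cdot> e2 = zero_arr C A A" "s \<cdot> e2 = Id C A"
    and t: "q1 \<cdot> t = zero_arr C A A" "q2 \<cdot> t = Id C A"
  shows "\<exists>u \<in> Hom C P Q. q1 \<cdot> u = p \<and> q2 \<cdot> u = q"
proof -
  have pt: "pointed C" and bp: "has_binary_products C"
    using sub by (simp_all add: subtractive_def)
  have pq: "p \<in> Hom C P A" "q \<in> Hom C P A" and PO: "P \<in> Obj C"
    using P by (auto simp: binary_product_def)
  have QO: "Q \<in> Obj C" using s Dom_Obj by (auto simp: Hom_def)
  define n where "n = s \<cdot> t"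
  note arr = q[unfolded Hom_def, simplified] e[unfolded Hom_def, simplified]
    s[unfolded Hom_def, simplified] pq[unfolded Hom_def, simplified]
  note red = e1 e2 t e1[THEN reassoc] e2[THEN reassoc] t[THEN reassoc]
    n_def[symmetric] n_def[symmetric, THEN reassoc]
  note rules = cat_simps zero_closed[OF pt] comp_zero[OF pt] zero_comp[OF pt] Hom_def
  have n: "n \<in> Arr C" "Dom C n = A" "Cod C n = A"
    using arr by (auto simp: n_def rules)
  obtain QQ h k where QQ: "binary_product C Q Q QQ h k"
    using bp QO unfolding has_binary_products_def by metis
  have hk: "h \<in> Hom C QQ Q" "k \<in> Hom C QQ Q"
    using QQ by (auto simp: binary_product_def)
  note arr_hk = hk[unfolded Hom_def, simplified]
  \<comment> \<open>The relation \<open>(x, y) \<in> Q \<and> (x, s(x, y)) \<in> Q \<and> s(x, s(x, y)) = y\<close>.\<close>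
  let ?F = "{(q1 \<cdot> k, q1 \<cdot> h), (q2 \<cdot> k, s \<cdot> h), (s \<cdot> k, q2 \<cdot> h)}"
  \<comment> \<open>Since s(x, x) = 0 and s(x, 0) = x, the pairs (x, x) and (x, 0) are companions of
    each other: when \<open>h\<close> is one of them, \<open>k\<close> is the other.\<close>
  obtain d1 where d1: "d1 \<in> Arr C" "Dom C d1 = A" "Cod C d1 = QQ" "h \<cdot> d1 = e1" "k \<cdot> d1 = e2"
    using pairing_props[OF QQ e(1,2)] by (auto simp: Hom_def)
  obtain d2 where d2: "d2 \<in> Arr C" "Dom C d2 = A" "Cod C d2 = QQ" "h \<cdot> d2 = e2" "k \<cdot> d2 = e1"
    using pairing_props[OF QQ e(2,1)] by (auto simp: Hom_def)
  have "\<exists>d3 \<in> Hom C A QQ. (\<forall>(u, v) \<in> ?F. u \<cdot> d3 = v \<cdot> d3) \<and>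
    (q1 \<cdot> h) \<cdot> d3 = zero_arr C A A \<and> (q2 \<cdot> h) \<cdot> d3 = Id C A"
  proof (rule subtractive_equations[OF sub fc A, of _ QQ _ _ d1 d2])
    show "x = y" if x: "x \<in> Hom C X QQ" and y: "y \<in> Hom C X QQ"
      and F: "\<forall>(u, v) \<in> ?F. u \<cdot> x = v \<cdot> x" "\<forall>(u, v) \<in> ?F. u \<cdot> y = v \<cdot> y"
      and eq: "(q1 \<cdot> h) \<cdot> x = (q1 \<cdot> h) \<cdot> y" "(q2 \<cdot> h) \<cdot> x = (q2 \<cdot> h) \<cdot> y" for X x y
    proof -
      have h: "h \<cdot> x = h \<cdot> y"
        by (rule mono) (use x y eq arr arr_hk in \<open>auto simp: rules\<close>)
      have k: "k \<cdot> x = k \<cdot> y"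
        by (rule mono) (use x y F h arr arr_hk in \<open>auto simp: rules\<close>)
      show ?thesis
        by (rule product_arr_eqI[OF QQ x y h k])
    qed
    show "\<forall>(u, v) \<in> ?F. \<exists>T. u \<in> Hom C QQ T \<and> v \<in> Hom C QQ T"
      using arr arr_hk by (auto simp: rules)
  qed (use arr arr_hk d1 d2 A in \<open>auto simp: rules red\<close>)
  then obtain d3 where d3: "d3 \<in> Hom C A QQ" and d3F: "\<forall>(u, v) \<in> ?F. u \<cdot> d3 = v \<cdot> d3"
    "(q1 \<cdot> h) \<cdot> d3 = zero_arr C A A" "(q2 \<cdot> h) \<cdot> d3 = Id C A"
    by blast
  \<comment> \<open>At the pair (0, x) the relation has \<open>h\<close> = (0, x) and
    \<open>k\<close> = (0, n x), so its third equation reads n(n x) = x.\<close>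
  have hd: "h \<cdot> d3 = t"
    by (rule mono) (use d3 d3F arr arr_hk A in \<open>auto simp: rules red\<close>)
  have kd: "k \<cdot> d3 = t \<cdot> n"
    by (rule mono) (use d3 d3F hd n arr arr_hk A in \<open>auto simp: rules red\<close>)
  have nn: "n \<cdot> n = Id C A"
    using d3 d3F hd kd n arr arr_hk A by (auto simp: rules red)
  \<comment> \<open>The relation \<open>(x1, y1) \<in> Q \<and> (s(x1, y1), y2) \<in> Q\<close> between \<open>(x1, x2)\<close> and \<open>(y1, y2)\<close>.\<close>
  obtain D c w where D: "binary_product C A QQ D c w"
    using bp A hk(1) Dom_Obj unfolding has_binary_products_def Hom_def by blast
  have cw: "c \<in> Hom C D A" "w \<in> Hom C D QQ"
    using D by (auto simp: binary_product_def)
  \<comment> \<open>\<open>D\<close> is A \<times> Q \<times> Q: \<open>c\<close> is the free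
    coordinate x2, \<open>a\<close> is (x1, y1), and \<open>b\<close> is (s(x1, y1), y2) once the
    equation in \<open>?G\<close> holds.\<close>
  define a b where "a = h \<cdot> w" and "b = k \<cdot> w"
  have ab: "a \<in> Hom C D Q" "b \<in> Hom C D Q"
    using Comp_Hom[OF cw(2)] hk by (auto simp: a_def b_def)
  have D_eqI: "x = y" if x: "x \<in> Hom C X D" and y: "y \<in> Hom C X D"
    and eq: "c \<cdot> x = c \<cdot> y" "a \<cdot> x = a \<cdot> y" "b \<cdot> x = b \<cdot> y" for X x y
  proof (rule product_arr_eqI[OF D x y eq(1)], rule product_arr_eqI[OF QQ])
    show "w \<cdot> x \<in> Hom C X QQ" "w \<cdot> y \<in> Hom C X QQ"
      using Comp_Hom cw(2) x y by auto
    show "h \<cdot> (w \<cdot> x) = h \<cdot> (w \<cdot> y)" "k \<cdot> (w \<cdot> x) = k \<cdot> (w \<cdot> y)"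
      using eq Comp_assoc[OF x cw(2)] Comp_assoc[OF y cw(2)] hk by (auto simp: a_def b_def)
  qed
  have D_ex: "\<exists>d. d \<in> Arr C \<and> Dom C d = X \<and> Cod C d = D \<and> c \<cdot> d = x \<and> a \<cdot> d = y \<and> b \<cdot> d = z"
    if x: "x \<in> Hom C X A" and yz: "y \<in> Hom C X Q" "z \<in> Hom C X Q" for X x y z
  proof -
    note v = pairing_props[OF QQ yz]
    note d = pairing_props[OF D x v(1)]
    show ?thesis
      using v d Comp_assoc[OF d(1) cw(2)] hk
      by (intro exI[of _ "pairing C c w x (pairing C h k y z)"]) (auto simp: a_def b_def Hom_def)
  qed
  note arr_D = cw[unfolded Hom_def, simplified] ab[unfolded Hom_def, simplified]
  let ?G = "{(q1 \<cdot> b, s \<cdot> a)}"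
  define r1 r2 where "r1 = pairing C p q (q1 \<cdot> a) c" and "r2 = pairing C p q (q2 \<cdot> a) (q2 \<cdot> b)"
  have r: "r1 \<in> Hom C D P" "p \<cdot> r1 = q1 \<cdot> a" "q \<cdot> r1 = c"
    "r2 \<in> Hom C D P" "p \<cdot> r2 = q2 \<cdot> a" "q \<cdot> r2 = q2 \<cdot> b"
    using pairing_props[OF P Comp_Hom[OF ab(1) q(1)] cw(1)]
      pairing_props[OF P Comp_Hom[OF ab(1) q(2)] Comp_Hom[OF ab(2) q(2)]]
    by (auto simp: r1_def r2_def)
  note arr_r = r(1,4)[unfolded Hom_def, simplified]
  have rx: "q1 \<cdot> (a \<cdot> x) = p \<cdot> (r1 \<cdot> x)" "c \<cdot> x = q \<cdot> (r1 \<cdot> x)"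
    "q2 \<cdot> (a \<cdot> x) = p \<cdot> (r2 \<cdot> x)" "q2 \<cdot> (b \<cdot> x) = q \<cdot> (r2 \<cdot> x)" if x: "x \<in> Hom C X D" for X x
    using x r(2,3,5,6)[THEN reassoc, of x] arr arr_D arr_r by (auto simp: rules)
  \<comment> \<open>For y = x the difference s(x1, x1) vanishes and \<open>b\<close> = (0, x2) is
    supplied by \<open>t\<close>; for y = 0 it is x1 and \<open>b\<close> = (x1, 0) is supplied by
    \<open>e2\<close>.\<close>
  obtain d1 where d1: "d1 \<in> Arr C" "Dom C d1 = P" "Cod C d1 = D"
    "c \<cdot> d1 = q" "a \<cdot> d1 = e1 \<cdot> p" "b \<cdot> d1 = t \<cdot> q"
    using D_ex[OF pq(2) Comp_Hom[OF pq(1) e(1)] Comp_Hom[OF pq(2) e(3)]] by blast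
  obtain d2 where d2: "d2 \<in> Arr C" "Dom C d2 = P" "Cod C d2 = D"
    "c \<cdot> d2 = q" "a \<cdot> d2 = e2 \<cdot> p" "b \<cdot> d2 = e2 \<cdot> p"
    using D_ex[OF pq(2) Comp_Hom[OF pq(1) e(2)] Comp_Hom[OF pq(1) e(2)]] by blast
  have d12: "d1 \<in> Hom C P D" "d2 \<in> Hom C P D" using d1 d2 by (auto simp: Hom_def)
  have "\<exists>d3 \<in> Hom C P D. (\<forall>(u, v) \<in> ?G. u \<cdot> d3 = v \<cdot> d3) \<and>
    r1 \<cdot> d3 = zero_arr C P P \<and> r2 \<cdot> d3 = Id C P"
  proof (rule subtractive_equations[OF sub fc PO r(1,4), of _ d1 d2])
    show "x = y" if x: "x \<in> Hom C X D" and y: "y \<in> Hom C X D"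
      and G: "\<forall>(u, v) \<in> ?G. u \<cdot> x = v \<cdot> x" "\<forall>(u, v) \<in> ?G. u \<cdot> y = v \<cdot> y"
      and eq: "r1 \<cdot> x = r1 \<cdot> y" "r2 \<cdot> x = r2 \<cdot> y" for X x y
    proof -
      have a: "a \<cdot> x = a \<cdot> y"
        by (rule mono[of _ X]) (use x y eq rx[OF x] rx[OF y] arr arr_D in \<open>auto simp: rules\<close>)
      have q1b: "q1 \<cdot> (b \<cdot> x) = q1 \<cdot> (b \<cdot> y)"
        using x y G a arr arr_D by (auto simp: rules)
      have b: "b \<cdot> x = b \<cdot> y"
        by (rule mono[of _ X]) (use q1b x y eq rx[OF x] rx[OF y] arr arr_D in \<open>auto simp: rules\<close>)
      show ?thesis
        by (rule D_eqI[OF x y _ a b]) (use eq rx[OF x] rx[OF y] in auto)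
    qed
    show "\<forall>(u, v) \<in> ?G. \<exists>T. u \<in> Hom C D T \<and> v \<in> Hom C D T"
      using arr arr_D by (auto simp: rules)
    show "r1 \<cdot> d1 = Id C P" "r2 \<cdot> d1 = Id C P" "r1 \<cdot> d2 = Id C P" "r2 \<cdot> d2 = zero_arr C P P"
      by (rule product_arr_eqI[OF P, of _ P];
          use rx[OF d12(1)] rx[OF d12(2)] d1 d2 arr arr_D arr_r PO A in \<open>simp add: rules red\<close>)+
  qed (use arr arr_D d1 d2 PO A in \<open>auto simp: rules red\<close>)
  then obtain d3 where d3: "d3 \<in> Hom C P D" and d3G: "(q1 \<cdot> b) \<cdot> d3 = (s \<cdot> a) \<cdot> d3"
    "r1 \<cdot> d3 = zero_arr C P P" "r2 \<cdot> d3 = Id C P"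
    by blast
  \<comment> \<open>With x = 0, \<open>a\<close> is (0, y1), so s(0, y1) = n y1 and \<open>b\<close>
    exhibits (n y1, y2) as an element of \<open>Q\<close>.\<close>
  have ad: "a \<cdot> d3 = t \<cdot> p"
    by (rule mono[of _ P]) (use d3 d3G rx[OF d3] arr arr_D A PO in \<open>auto simp: rules red\<close>)
  define v where "v = b \<cdot> d3"
  have v: "v \<in> Hom C P Q" "q1 \<cdot> v = n \<cdot> p" "q2 \<cdot> v = q"
    using d3 d3G rx[OF d3] ad n arr arr_D A PO by (auto simp: v_def rules red)
  have np: "n \<cdot> p \<in> Hom C P A" using n arr by (auto simp: rules)
  \<comment> \<open>Substituting n y1 for y1 cancels \<open>n\<close>, an involution by
    \<open>nn\<close>.\<close>
  define \<nu> where "\<nu> = pairing C p q (n \<cdot> p) q"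
  note \<nu> = pairing_props[OF P np pq(2), folded \<nu>_def]
  have "v \<cdot> \<nu> \<in> Hom C P Q" "q1 \<cdot> (v \<cdot> \<nu>) = p" "q2 \<cdot> (v \<cdot> \<nu>) = q"
    using v(1) \<nu> n arr v(2,3)[THEN reassoc, of \<nu>] nn[THEN reassoc, of p] by (auto simp: rules)
  then show ?thesis by blast
qed

text \<open>The factorization \<open>c = m \<cdot> e\<close> makes \<open>Q\<close> both a relation
  (\<open>m\<close> is monic) and a quotient of the sum (\<open>e\<close> is epic), so both
  subtractivity hypotheses apply to it. Once \<open>m\<close> is invertible, the two generators are
  jointly epic into \<open>P\<close> because they are so into \<open>Q\<close>.\<close>

lemma subtraction_ex:
  assumes sub: "subtractive C" and cosub: "subtractive (op_cat C)"
    and fc: "finitely_complete C" and fac: "has_mono_epi_factorizations C"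
    and A: "A \<in> Obj C" and P: "binary_product C A A P p q"
  shows "\<exists>s. s \<in> Hom C P A \<and>
    s \<cdot> pairing C p q (Id C A) (Id C A) = zero_arr C A A \<and>
    s \<cdot> pairing C p q (Id C A) (zero_arr C A A) = Id C A \<and>
    (\<forall>B. \<forall>g \<in> Hom C P B. \<forall>h \<in> Hom C P B.
      g \<cdot> pairing C p q (Id C A) (Id C A) = h \<cdot> pairing C p q (Id C A) (Id C A) \<longrightarrow>
      g \<cdot> pairing C p q (Id C A) (zero_arr C A A) = h \<cdot> pairing C p q (Id C A) (zero_arr C A A) \<longrightarrow>
      g = h)"
proof -
  have pt: "pointed C" using sub by (simp add: subtractive_def)
  have pq: "p \<in> Hom C P A" "q \<in> Hom C P A" and PO: "P \<in> Obj C"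
    using P by (auto simp: binary_product_def)
  note rules = cat_simps zero_closed[OF pt] comp_zero[OF pt] zero_comp[OF pt] Hom_def
  have idz: "Id C A \<in> Hom C A A" "zero_arr C A A \<in> Hom C A A"
    using A by (auto simp: rules)
  define \<delta> \<iota> where "\<delta> = pairing C p q (Id C A) (Id C A)"
    and "\<iota> = pairing C p q (Id C A) (zero_arr C A A)"
  note \<delta> = pairing_props[OF P idz(1) idz(1), folded \<delta>_def]
  note \<iota> = pairing_props[OF P idz(1) idz(2), folded \<iota>_def]
  obtain S i j where S: "binary_product (op_cat C) A A S i j"
    using cosub A unfolding subtractive_def has_binary_products_def op_cat_simps by metis
  have ij: "i \<in> Hom C A S" "j \<in> Hom C A S"
    using S by (auto simp: binary_product_def)
  \<comment> \<open>Products in \<open>op_cat C\<close> are sums in \<open>C\<close>, so the pairing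
    lemma read there yields the copairing of \<open>\<delta>\<close> and
    \<open>\<iota>\<close>.\<close>
  obtain c where c: "c \<in> Hom C S P" "c \<cdot> i = \<delta>" "c \<cdot> j = \<iota>"
    using category.pairing_props[OF category_op_cat[OF category_axioms] S, of \<delta> P \<iota>] \<delta>(1) \<iota>(1) by auto
  obtain m e where me: "mono_arr C m" "epi_arr C e" "Cod C e = Dom C m" "c = m \<cdot> e"
    using fac c(1) unfolding has_mono_epi_factorizations_def Hom_def by blast
  define Q where "Q = Dom C m"
  have m: "m \<in> Hom C Q P" and e: "e \<in> Hom C S Q"
    using me c(1) by (auto simp: mono_arr_def epi_arr_def Q_def rules)
  note arr = m[unfolded Hom_def, simplified] e[unfolded Hom_def, simplified]
    ij[unfolded Hom_def, simplified] pq[unfolded Hom_def, simplified]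
  have mono: "x = y" if x: "x \<in> Hom C X Q" and y: "y \<in> Hom C X Q"
    and eq: "(p \<cdot> m) \<cdot> x = (p \<cdot> m) \<cdot> y" "(q \<cdot> m) \<cdot> x = (q \<cdot> m) \<cdot> y" for X x y
  proof -
    have "m \<cdot> x = m \<cdot> y"
      by (rule product_arr_eqI[OF P, of _ X]) (use x y eq arr in \<open>auto simp: rules\<close>)
    then show ?thesis
      using me(1) x y unfolding mono_arr_def Q_def by blast
  qed
  have epi: "x = y" if x: "x \<in> Hom C Q X" and y: "y \<in> Hom C Q X"
    and eq: "x \<cdot> (e \<cdot> i) = y \<cdot> (e \<cdot> i)" "x \<cdot> (e \<cdot> j) = y \<cdot> (e \<cdot> j)" for X x y
  proof -
    have "x \<cdot> e = y \<cdot> e"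
      by (rule category.product_arr_eqI[OF category_op_cat[OF category_axioms] S, of _ X])
        (use x y eq arr in \<open>auto simp: rules\<close>)
    then show ?thesis
      using me(2,3) x y unfolding epi_arr_def Q_def by metis
  qed
  have mei: "m \<cdot> (e \<cdot> i) = \<delta>" "m \<cdot> (e \<cdot> j) = \<iota>"
    using c me(4) arr by (auto simp: rules)
  have qs: "p \<cdot> m \<in> Hom C Q A" "q \<cdot> m \<in> Hom C Q A"
    and es: "e \<cdot> i \<in> Hom C A Q" "e \<cdot> j \<in> Hom C A Q"
    using arr by (auto simp: rules)
  have gens: "(p \<cdot> m) \<cdot> (e \<cdot> i) = Id C A" "(q \<cdot> m) \<cdot> (e \<cdot> i) = Id C A"
    "(p \<cdot> m) \<cdot> (e \<cdot> j) = Id C A" "(q \<cdot> m) \<cdot> (e \<cdot> j) = zero_arr C A A"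
    using mei \<delta> \<iota> Comp_assoc[OF es(1) m] Comp_assoc[OF es(2) m] pq by auto
  obtain t where t: "t \<in> Hom C A Q" "(p \<cdot> m) \<cdot> t = zero_arr C A A" "(q \<cdot> m) \<cdot> t = Id C A"
  proof -
    have "\<exists>t \<in> Hom C A Q. (p \<cdot> m) \<cdot> t = zero_arr C A A \<and> (q \<cdot> m) \<cdot> t = Id C A"
      by (rule subtractive_jointly_monic[OF sub A qs _ es(1) gens(1,2) es(2) gens(3,4)]) (rule mono)
    then show ?thesis using that by blast
  qed
  \<comment> \<open>In the dual, projections and generators exchange roles: along
    \<open>e \<cdot> i\<close> and \<open>e \<cdot> j\<close>, the arrow \<open>p \<cdot> m\<close>
    has components 1, 1 and \<open>q \<cdot> m\<close> has components 1, 0. The arrow with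
    components 0, 1 is \<open>s\<close>.\<close>
  have "\<exists>s \<in> Hom (op_cat C) A Q. (e \<cdot> i) \<cdot>\<^bsub>op_cat C\<^esub> s = zero_arr (op_cat C) A A \<and>
      (e \<cdot> j) \<cdot>\<^bsub>op_cat C\<^esub> s = Id (op_cat C) A"
    by (rule category.subtractive_jointly_monic[OF category_op_cat[OF category_axioms] cosub,
          of _ _ _ _ "p \<cdot> m" "q \<cdot> m"])
      (use A qs es epi gens in \<open>auto simp: zero_arr_op_cat\<close>)
  then obtain s where s: "s \<in> Hom C Q A" "s \<cdot> (e \<cdot> i) = zero_arr C A A" "s \<cdot> (e \<cdot> j) = Id C A"
    by (auto simp: zero_arr_op_cat)
  obtain u where u: "u \<in> Hom C P Q" "(p \<cdot> m) \<cdot> u = p" "(q \<cdot> m) \<cdot> u = q"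
  proof -
    have "\<exists>u \<in> Hom C P Q. (p \<cdot> m) \<cdot> u = p \<and> (q \<cdot> m) \<cdot> u = q"
      by (rule subtraction_domain_total[OF sub fc A P qs _ es t(1) s(1) gens(1,2) s(2) gens(3,4)
            s(3) t(2,3)]) (rule mono)
    then show ?thesis using that by blast
  qed
  \<comment> \<open>That \<open>Q\<close> contains the generic pair (\<open>p\<close>,
    \<open>q\<close>) means that \<open>m\<close> has a right inverse \<open>u\<close>; as
    \<open>m\<close> is monic, the inverse is two-sided.\<close>
  have mu: "m \<cdot> u = Id C P"
    by (rule product_arr_eqI[OF P, of _ P]) (use u arr PO in \<open>auto simp: rules\<close>)
  have um: "u \<cdot> m = Id C Q"
    by (rule mono[of _ Q]) (use u arr m mu Dom_Obj[of m] in \<open>auto simp: rules mu[THEN reassoc]\<close>)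
  have u\<delta>: "u \<cdot> \<delta> = e \<cdot> i" "u \<cdot> \<iota> = e \<cdot> j"
    using u(1) arr um by (auto simp: rules mei[symmetric] um[THEN reassoc])
  have "g = h" if g: "g \<in> Hom C P B" and h: "h \<in> Hom C P B"
    and eq: "g \<cdot> \<delta> = h \<cdot> \<delta>" "g \<cdot> \<iota> = h \<cdot> \<iota>" for B g h
  proof -
    have "g \<cdot> m = h \<cdot> m"
      by (rule epi[of _ B]) (use g h eq mei arr in \<open>auto simp: rules\<close>)
    then have "(g \<cdot> m) \<cdot> u = (h \<cdot> m) \<cdot> u" by simp
    then show ?thesis
      using g h mu u(1) arr by (auto simp: rules)
  qed
  moreover have "s \<cdot> u \<in> Hom C P A" "(s \<cdot> u) \<cdot> \<delta> = zero_arr C A A" "(s \<cdot> u) \<cdot> \<iota> = Id C A"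
    using Comp_Hom[OF u(1) s(1)] Comp_assoc[OF \<delta>(1) u(1) s(1)] Comp_assoc[OF \<iota>(1) u(1) s(1)] u\<delta> s
    by auto
  ultimately show ?thesis
    unfolding \<delta>_def \<iota>_def by blast
qed

end

section \<open>Abelian groups from subtractions\<close>

text \<open>Write d x y as x - y and put x + y = x - (0 - y). The entropic law passes to an
  interchange law for this addition, and interchange with a unit forces associativity and
  commutativity, as in the Eckmann-Hilton argument.\<close>

lemma entropic_subtraction_group:
  fixes G :: "'a set" and d :: "'a \<Rightarrow> 'a \<Rightarrow> 'a" and z :: 'a
  assumes closed: "z \<in> G" "\<And>x y. x \<in> G \<Longrightarrow> y \<in> G \<Longrightarrow> d x y \<in> G"
    and self: "\<And>x. x \<in> G \<Longrightarrow> d x x = z"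
    and right: "\<And>x. x \<in> G \<Longrightarrow> d x z = x"
    and entropic: "\<And>a b c e. a \<in> G \<Longrightarrow> b \<in> G \<Longrightarrow> c \<in> G \<Longrightarrow> e \<in> G \<Longrightarrow>
      d (d a b) (d c e) = d (d a c) (d b e)"
  shows "comm_group \<lparr>carrier = G, mult = (\<lambda>x y. d x (d z y)), one = z\<rparr>"
proof -
  \<comment> \<open>The instance (y - y) - (0 - y) = (y - 0) - (y - y).\<close>
  have neg: "d z (d z y) = y" if "y \<in> G" for y
    using entropic[of y y z y] that closed self right by simp
  \<comment> \<open>This is (a + b) + (c + e) = (a + c) + (b + e); \<open>dist\<close> says that
    negation is additive. Associativity is the case c = 0, commutativity the case a = e = 0.\<close>
  have medial: "d (d a (d z b)) (d z (d c (d z e))) = d (d a (d z c)) (d z (d b (d z e)))"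
    if "a \<in> G" "b \<in> G" "c \<in> G" "e \<in> G" for a b c e
  proof -
    have dist: "d z (d x (d z y)) = d (d z x) (d z (d z y))" if "x \<in> G" "y \<in> G" for x y
      using entropic[of z z x "d z y"] that closed self by simp
    show ?thesis
      using that closed by (simp add: dist entropic)
  qed
  have assoc: "d (d x (d z y)) (d z w) = d x (d z (d y (d z w)))"
    if "x \<in> G" "y \<in> G" "w \<in> G" for x y w
    using medial[of x y z w] that closed neg right self[of z] by simp
  have comm: "d x (d z y) = d y (d z x)" if "x \<in> G" "y \<in> G" for x y
    using medial[of z x y z] that closed neg right self[of z] by simp
  \<comment> \<open>By \<open>neg\<close> the witness is just \<open>d z x\<close>, the negative of
    x.\<close>
  have inverse: "\<exists>y \<in> G. d y (d z x) = z" if "x \<in> G" for x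
    using that closed self by (intro bexI[of _ "d z (d z (d z x))"]) (simp_all add: neg)
  show ?thesis
    by (rule comm_groupI) (use closed right neg assoc comm inverse in simp_all)
qed

lemma (in category) additive_of_subtractive:
  assumes sub: "subtractive C" and cosub: "subtractive (op_cat C)"
    and fc: "finitely_complete C" and fac: "has_mono_epi_factorizations C"
  shows "additive_category C"
proof -
  have pt: "pointed C" and bp: "has_binary_products C"
    using sub by (simp_all add: subtractive_def)
  \<comment> \<open>A product, and below a subtraction, is chosen for every object at once; values
    outside \<open>Obj C\<close> are arbitrary.\<close>
  obtain P p q where P: "\<And>A. A \<in> Obj C \<Longrightarrow> binary_product C A A (P A) (p A) (q A)"
  proof -
    have "\<forall>A. \<exists>T. A \<in> Obj C \<longrightarrow> binary_product C A A (fst T) (fst (snd T)) (snd (snd T))"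
      using bp unfolding has_binary_products_def by (metis fst_conv snd_conv)
    then show ?thesis
      by (rule choice[THEN exE]) (rule that; blast)
  qed
  define pr where "pr = (\<lambda>A. pairing C (p A) (q A))"
  have pr_fold: "pairing C (p A) (q A) = pr A" for A by (simp add: pr_def)
  let ?z = "zero_arr C"
  obtain s where s: "\<And>A. A \<in> Obj C \<Longrightarrow> s A \<in> Hom C (P A) A"
      "\<And>A. A \<in> Obj C \<Longrightarrow> s A \<cdot> pr A (Id C A) (Id C A) = ?z A A"
      "\<And>A. A \<in> Obj C \<Longrightarrow> s A \<cdot> pr A (Id C A) (?z A A) = Id C A"
    and epi: "\<And>A B g h. A \<in> Obj C \<Longrightarrow> g \<in> Hom C (P A) B \<Longrightarrow> h \<in> Hom C (P A) B \<Longrightarrow>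
      g \<cdot> pr A (Id C A) (Id C A) = h \<cdot> pr A (Id C A) (Id C A) \<Longrightarrow>
      g \<cdot> pr A (Id C A) (?z A A) = h \<cdot> pr A (Id C A) (?z A A) \<Longrightarrow> g = h"
  proof -
    have "\<forall>A. \<exists>s. A \<in> Obj C \<longrightarrow> s \<in> Hom C (P A) A \<and> s \<cdot> pr A (Id C A) (Id C A) = ?z A A \<and>
      s \<cdot> pr A (Id C A) (?z A A) = Id C A \<and>
      (\<forall>B. \<forall>g \<in> Hom C (P A) B. \<forall>h \<in> Hom C (P A) B.
        g \<cdot> pr A (Id C A) (Id C A) = h \<cdot> pr A (Id C A) (Id C A) \<longrightarrow>
        g \<cdot> pr A (Id C A) (?z A A) = h \<cdot> pr A (Id C A) (?z A A) \<longrightarrow> g = h)"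
      using subtraction_ex[OF sub cosub fc fac _ P] unfolding pr_def by blast
    then show ?thesis
      by (rule choice[THEN exE]) (rule that; blast)
  qed
  have pq: "p A \<in> Hom C (P A) A" "q A \<in> Hom C (P A) A" "P A \<in> Obj C" if "A \<in> Obj C" for A
    using P[OF that] by (auto simp: binary_product_def)
  note pr = pairing_props[OF P, unfolded pr_fold]
  note pr_eq = pairing_eq[OF P, unfolded pr_fold]
  have objs: "X \<in> Obj C" "A \<in> Obj C" if "f \<in> Hom C X A" for f X A
    using that Dom_Obj Cod_Obj by (auto simp: Hom_def)
  have z: "?z X A \<in> Hom C X A" if "X \<in> Obj C" "A \<in> Obj C" for X A
    using that zero_closed[OF pt] by (simp add: Hom_def)
  have cz: "f \<cdot> ?z X A = ?z X B" if "f \<in> Hom C A B" "X \<in> Obj C" for f X A B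
    using that comp_zero[OF pt, of f X A] by (simp add: Hom_def)
  have zc: "?z A B \<cdot> f = ?z X B" if "f \<in> Hom C X A" "B \<in> Obj C" for f X A B
    using that zero_comp[OF pt, of f B A] by (simp add: Hom_def)
  have pr_comp: "pr A f g \<cdot> h = pr A (f \<cdot> h) (g \<cdot> h)"
    if "f \<in> Hom C X A" "g \<in> Hom C X A" "h \<in> Hom C Y X" for f g h X Y A
  proof -
    have A: "A \<in> Obj C" using objs that by blast
    note fg = pr[OF A that(1,2)]
    show ?thesis
      by (rule pr_eq[OF A Comp_Hom[OF that(3,1)] Comp_Hom[OF that(3,2)]
            Comp_Hom[OF that(3) fg(1)], symmetric])
        (use fg(2,3) Comp_assoc[OF that(3) fg(1) pq(1)[OF A]]
          Comp_assoc[OF that(3) fg(1) pq(2)[OF A]] in simp_all)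
  qed
  \<comment> \<open>The difference f - g of generalized elements of \<open>A\<close>. Precomposition
    respects it because \<open>s A\<close> is applied last; compatibility with postcomposition is
    the real content.\<close>
  define d where "d = (\<lambda>A f g. s A \<cdot> pr A f g)"
  have d: "d A f g \<in> Hom C X A" if "f \<in> Hom C X A" "g \<in> Hom C X A" for f g X A
    unfolding d_def using Comp_Hom[OF pr(1)[OF _ that] s(1)] objs(2)[OF that(1)] by blast
  have d_comp: "d A f g \<cdot> h = d A (f \<cdot> h) (g \<cdot> h)"
    if "f \<in> Hom C X A" "g \<in> Hom C X A" "h \<in> Hom C Y X" for f g h X Y A
  proof -
    have A: "A \<in> Obj C" using objs that by blast
    show ?thesis
      using Comp_assoc[OF that(3) pr(1)[OF A that(1,2)] s(1)[OF A]] pr_comp[OF that]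
      by (simp add: d_def)
  qed
  have d_self: "d A f f = ?z X A" if f: "f \<in> Hom C X A" for f X A
  proof -
    have A: "A \<in> Obj C" "Id C A \<in> Hom C A A" using objs f Id_Hom by auto
    show ?thesis
      using d_comp[OF A(2) A(2) f] s(2)[OF A(1)] zc[OF f A(1)] Comp_Id_left[OF f] by (simp add: d_def)
  qed
  have d_zero: "d A f (?z X A) = f" if f: "f \<in> Hom C X A" for f X A
  proof -
    have A: "A \<in> Obj C" "Id C A \<in> Hom C A A" using objs f Id_Hom by auto
    show ?thesis
      using d_comp[OF A(2) z[OF A(1,1)] f] s(3)[OF A(1)] zc[OF f A(1)] Comp_Id_left[OF f]
      by (simp add: d_def)
  qed
  \<comment> \<open>The generic case, f and g being the projections. Both sides are arrows out of
    the product, so joint epimorphy reduces the claim to (1, 1), where both give 0, and (1, 0),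
    where both give \<open>k\<close>.\<close>
  have natural_generic: "k \<cdot> s A = d B (k \<cdot> p A) (k \<cdot> q A)" if k: "k \<in> Hom C A B" for k A B
  proof -
    have A: "A \<in> Obj C" and idA: "Id C A \<in> Hom C A A" and zA: "?z A A \<in> Hom C A A"
      using objs k Id_Hom z by auto
    note kp = Comp_Hom[OF pq(1)[OF A] k] and kq = Comp_Hom[OF pq(2)[OF A] k]
    note pr1 = pr[OF A idA idA] and pr2 = pr[OF A idA zA]
    show ?thesis
    proof (rule epi[OF A Comp_Hom[OF s(1)[OF A] k] d[OF kp kq]])
      show "(k \<cdot> s A) \<cdot> pr A (Id C A) (Id C A) = d B (k \<cdot> p A) (k \<cdot> q A) \<cdot> pr A (Id C A) (Id C A)"
        using d_comp[OF kp kq pr1(1)] Comp_assoc[OF pr1(1) s(1)[OF A] k]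
          Comp_assoc[OF pr1(1) pq(1)[OF A] k] Comp_assoc[OF pr1(1) pq(2)[OF A] k]
          pr1(2,3) s(2)[OF A] cz[OF k A] d_self[OF k] Comp_Id_right[OF k] by simp
      show "(k \<cdot> s A) \<cdot> pr A (Id C A) (?z A A) = d B (k \<cdot> p A) (k \<cdot> q A) \<cdot> pr A (Id C A) (?z A A)"
        using d_comp[OF kp kq pr2(1)] Comp_assoc[OF pr2(1) s(1)[OF A] k]
          Comp_assoc[OF pr2(1) pq(1)[OF A] k] Comp_assoc[OF pr2(1) pq(2)[OF A] k]
          pr2(2,3) s(3)[OF A] cz[OF k A] d_zero[OF k] Comp_Id_right[OF k] by simp
    qed
  qed
  have natural: "k \<cdot> d A f g = d B (k \<cdot> f) (k \<cdot> g)"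
    if f: "f \<in> Hom C X A" and g: "g \<in> Hom C X A" and k: "k \<in> Hom C A B" for k f g X A B
  proof -
    have A: "A \<in> Obj C" using objs k by auto
    note kp = Comp_Hom[OF pq(1)[OF A] k] and kq = Comp_Hom[OF pq(2)[OF A] k]
    note fg = pr[OF A f g]
    have "k \<cdot> d A f g = (k \<cdot> s A) \<cdot> pr A f g"
      unfolding d_def using Comp_assoc[OF fg(1) s(1)[OF A] k] by simp
    then show ?thesis
      using natural_generic[OF k] d_comp[OF kp kq fg(1)] fg(2,3)
        Comp_assoc[OF fg(1) pq(1)[OF A] k] Comp_assoc[OF fg(1) pq(2)[OF A] k] by simp
  qed
  \<comment> \<open>The subtraction \<open>s A\<close> is itself an arrow, so \<open>natural\<close>
    applies to it. The difference \<open>w\<close> of the pairs (a, b) and (c, e) has components a -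
    c and b - e, as the projections preserve differences too.\<close>
  have entropic: "d A (d A a b) (d A c e) = d A (d A a c) (d A b e)"
    if a: "a \<in> Hom C X A" and b: "b \<in> Hom C X A" and c: "c \<in> Hom C X A" and e: "e \<in> Hom C X A"
    for a b c e X A
  proof -
    have A: "A \<in> Obj C" using objs a by auto
    note ab = pr[OF A a b] and ce = pr[OF A c e]
    define w where "w = d (P A) (pr A a b) (pr A c e)"
    have w: "w \<in> Hom C X (P A)" "p A \<cdot> w = d A a c" "q A \<cdot> w = d A b e"
      using d[OF ab(1) ce(1)] natural[OF ab(1) ce(1) pq(1)[OF A]] natural[OF ab(1) ce(1) pq(2)[OF A]]
        ab ce by (auto simp: w_def)
    have "pr A (d A a c) (d A b e) = w"
      by (rule pr_eq[OF A d[OF a c] d[OF b e] w])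
    then have "d A (d A a c) (d A b e) = s A \<cdot> w" by (simp add: d_def)
    also have "\<dots> = d A (s A \<cdot> pr A a b) (s A \<cdot> pr A c e)"
      unfolding w_def by (rule natural[OF ab(1) ce(1) s(1)[OF A]])
    finally show ?thesis by (simp add: d_def)
  qed
  define H where "H = (\<lambda>X A. \<lparr>carrier = Hom C X A, mult = (\<lambda>f g. d A f (d A (?z X A) g)), one = ?z X A\<rparr>)"
  have group: "comm_group (H X A)" if "X \<in> Obj C" "A \<in> Obj C" for X A
    unfolding H_def
    by (rule entropic_subtraction_group) (use z that d d_self d_zero entropic in auto)
  \<comment> \<open>Composition on either side preserves differences and zero arrows, hence the
    addition built from them.\<close>
  have post: "k \<cdot> d B f (d B (?z A B) g) = d D (k \<cdot> f) (d D (?z A D) (k \<cdot> g))"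
    if "A \<in> Obj C" "B \<in> Obj C" "k \<in> Hom C B D" "f \<in> Hom C A B" "g \<in> Hom C A B" for k f g A B D
    using natural[OF that(4) d[OF z[OF that(1,2)] that(5)] that(3)]
      natural[OF z[OF that(1,2)] that(5,3)] cz[OF that(3,1)] by simp
  have pre: "d D f (d D (?z B D) g) \<cdot> k = d D (f \<cdot> k) (d D (?z A D) (g \<cdot> k))"
    if "B \<in> Obj C" "D \<in> Obj C" "k \<in> Hom C A B" "f \<in> Hom C B D" "g \<in> Hom C B D" for k f g A B D
    using d_comp[OF that(4) d[OF z[OF that(1,2)] that(5)] that(3)]
      d_comp[OF z[OF that(1,2)] that(5,3)] zc[OF that(3,2)] by simp
  have "ab_enrichment C H"
    unfolding ab_enrichment_def
    using group Comp_Hom by (simp add: H_def hom_def Pi_def post pre)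
  then show ?thesis
    using finite_products_of_limits[OF fc] category_axioms by (auto simp: additive_category_def)
qed

section \<open>From enrichment to subtractivity\<close>

text \<open>The difference f1 - f2 is the required factorization, because (1, 1) - (1, 0) = (0, 1)
  and composition is additive.\<close>

lemma (in category) subtractive_of_enrichment:
  assumes pt: "pointed C" and bp: "has_binary_products C" and H: "ab_enrichment C H"
  shows "subtractive C"
  unfolding subtractive_def
proof (intro conjI category_axioms pt bp ballI allI impI)
  fix A P p q R r
  assume A: "A \<in> Obj C"
    and *: "binary_product C A A P p q \<and> mono_arr C r \<and> r \<in> Hom C R P \<and>
      (\<exists>f1 \<in> Hom C A R. r \<cdot> f1 = pairing C p q (Id C A) (Id C A)) \<and>
      (\<exists>f2 \<in> Hom C A R. r \<cdot> f2 = pairing C p q (Id C A) (zero_arr C A A))"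
  then obtain f1 f2 where P: "binary_product C A A P p q" and r: "r \<in> Hom C R P"
    and f: "f1 \<in> Hom C A R" "f2 \<in> Hom C A R"
    and rf: "r \<cdot> f1 = pairing C p q (Id C A) (Id C A)"
      "r \<cdot> f2 = pairing C p q (Id C A) (zero_arr C A A)"
    by blast
  have pq: "p \<in> Hom C P A" "q \<in> Hom C P A" and PO: "P \<in> Obj C"
    using P by (auto simp: binary_product_def)
  have RO: "R \<in> Obj C" using r Dom_Obj by (auto simp: Hom_def)
  have grp: "comm_group (H X Y)" "carrier (H X Y) = Hom C X Y" if "X \<in> Obj C" "Y \<in> Obj C" for X Y
    using H that by (auto simp: ab_enrichment_def)
  have post: "group_hom (H X Y) (H X Z) (\<lambda>f. k \<cdot> f)"
    if "X \<in> Obj C" "Y \<in> Obj C" "Z \<in> Obj C" "k \<in> Hom C Y Z" for X Y Z k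
  proof -
    have "(\<lambda>f. k \<cdot> f) \<in> hom (H X Y) (H X Z)"
      using H that unfolding ab_enrichment_def by blast
    then show ?thesis
      using that grp(1) by (simp add: group_hom_def group_hom_axioms_def comm_group.axioms(2))
  qed
  have idz: "Id C A \<in> Hom C A A" "zero_arr C A A \<in> Hom C A A"
    using A Id_Hom zero_closed[OF pt] by (auto simp: Hom_def)
  \<comment> \<open>The set Hom(A, Z) has a single element, which is therefore its unit, and
    composing with \<open>h\<close> sends units to units.\<close>
  have one: "\<one>\<^bsub>H A A\<^esub> = zero_arr C A A"
  proof -
    obtain Z where Z: "zero_obj C Z" using pt by (auto simp: pointed_def)
    obtain g h where gh: "g \<in> Hom C A Z" "h \<in> Hom C Z A" and ZO: "Z \<in> Obj C"
      using Z A by (force simp: zero_obj_def terminal_obj_def initial_obj_def)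
    have "\<one>\<^bsub>H A Z\<^esub> \<in> Hom C A Z"
      using monoid.one_closed[of "H A Z"] grp[OF A ZO]
      by (simp add: comm_group_def comm_monoid_def)
    then have "g = \<one>\<^bsub>H A Z\<^esub>"
      using Z A gh by (auto simp: zero_obj_def terminal_obj_def)
    then show ?thesis
      using group_hom.hom_one[OF post[OF A ZO A gh(2)]] zero_arr_eq[OF Z gh] by simp
  qed
  interpret AR: comm_group "H A R" using grp A RO by blast
  interpret AA: comm_group "H A A" using grp A by blast
  define f3 where "f3 = f1 \<otimes>\<^bsub>H A R\<^esub> inv\<^bsub>H A R\<^esub> f2"
  have fR: "f1 \<in> carrier (H A R)" "f2 \<in> carrier (H A R)" using f grp A RO by auto
  then have "f3 \<in> carrier (H A R)" by (simp add: f3_def)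
  then have f3: "f3 \<in> Hom C A R" using grp(2)[OF A RO] by simp
  \<comment> \<open>Postcomposition with \<open>k \<cdot> r\<close> is a homomorphism. Taking
    \<open>p\<close> and \<open>q\<close> for \<open>k\<close> computes the coordinates as 1 - 1 = 0
    and 1 - 0 = 1.\<close>
  have k3: "k \<cdot> (r \<cdot> f3) = (k \<cdot> (r \<cdot> f1)) \<otimes>\<^bsub>H A A\<^esub> inv\<^bsub>H A A\<^esub> (k \<cdot> (r \<cdot> f2))"
    if k: "k \<in> Hom C P A" for k
  proof -
    interpret k: group_hom "H A R" "H A A" "\<lambda>f. (k \<cdot> r) \<cdot> f"
      by (rule post[OF A RO A Comp_Hom[OF r k]])
    have "(k \<cdot> r) \<cdot> f3 = ((k \<cdot> r) \<cdot> f1) \<otimes>\<^bsub>H A A\<^esub> inv\<^bsub>H A A\<^esub> ((k \<cdot> r) \<cdot> f2)"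
      unfolding f3_def using fR by (simp add: k.hom_mult k.hom_inv)
    then show ?thesis
      using Comp_assoc[OF _ r k] f f3 by simp
  qed
  note pr1 = pairing_props[OF P idz(1) idz(1)] and pr2 = pairing_props[OF P idz]
  have idH: "Id C A \<in> carrier (H A A)" using idz grp A by auto
  have "p \<cdot> (r \<cdot> f3) = zero_arr C A A" "q \<cdot> (r \<cdot> f3) = Id C A"
    using k3[OF pq(1)] k3[OF pq(2)] rf pr1 pr2 one[symmetric] idH by simp_all
  then have "r \<cdot> f3 = pairing C p q (zero_arr C A A) (Id C A)"
    using pairing_eq[OF P idz(2,1) Comp_Hom[OF f3 r]] by simp
  then show "\<exists>f3 \<in> Hom C A R. r \<cdot> f3 = pairing C p q (zero_arr C A A) (Id C A)"
    using f3 by blast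
qed

text \<open>Transposing the hom-groups exchanges the two homomorphism conditions.\<close>

lemma ab_enrichment_op_cat: "ab_enrichment C H \<Longrightarrow> ab_enrichment (op_cat C) (\<lambda>A B. H B A)"
  unfolding ab_enrichment_def op_cat_simps by blast

theorem theorem2p2:
  fixes C :: "('o, 'm) cat"
  assumes "category C"
    and "finitely_complete C"
    and "pointed C"
    and "has_binary_coproducts C"
    and "has_mono_epi_factorizations C"
  shows "additive_category C \<longleftrightarrow> subtractive C \<and> subtractive (op_cat C)"
proof
  interpret category C by fact
  interpret op: category "op_cat C" by (rule category_op_cat) fact
  assume "additive_category C"
  then obtain H where H: "ab_enrichment C H" and fp: "has_finite_products C"
    by (auto simp: additive_category_def)
  \<comment> \<open>Subtractivity of the dual comes from the same lemma applied in
    \<open>op_cat C\<close>, whose zero objects are those of \<open>C\<close> and whose products are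
    the sums of \<open>C\<close>.\<close>
  have "pointed (op_cat C)"
    using assms(3) by (simp add: pointed_def zero_obj_op_cat)
  moreover have "has_binary_products (op_cat C)"
    using assms(4) by (simp add: has_binary_products_def has_binary_coproducts_def binary_product_op_cat)
  ultimately show "subtractive C \<and> subtractive (op_cat C)"
    using subtractive_of_enrichment[OF assms(3) binary_products_of_finite[OF fp] H]
      op.subtractive_of_enrichment[OF _ _ ab_enrichment_op_cat[OF H]] by blast
next
  assume "subtractive C \<and> subtractive (op_cat C)"
  then show "additive_category C"
    using category.additive_of_subtractive assms by blast
qed

end
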